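(* Let $$h_l(d)=\frac{-d\log d-(1-d)\log(1-d)+d\log 6}{(1+d)\log 2},\qquad h_u(t)=\frac{-(1-t)\log_2(1-t)-t\log_2(t)+t}{1+t},$$ both with domain $(0,\frac12]$. Then the lower bound $\frac{h_l^{-1}(\alpha)}{1+h_l^{-1}(\alpha)}$ and the upper bound $\frac{h_u^{-1}(\alpha)}{1+h_u^{-1}(\alpha)}$ (for $\alpha\in(0,1)$) are asymptotically equal as $\alpha\to0+$, i.e. $$\lim_{\alpha\to0+}\ \frac{h_l^{-1}(\alpha)\big/\big(1+h_l^{-1}(\alpha)\big)}{h_u^{-1}(\alpha)\big/\big(1+h_u^{-1}(\alpha)\big)}=1.$$
   Context: Both $h_l$ and $h_u$ are strictly increasing on $(0,\frac12]$ with ranges containing $(0,1]$; $h_l^{-1}$ and $h_u^{-1}$ denote their inverses. *)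

theory Defs
  imports "HOL-Analysis.Analysis"
begin

(* Both functions are considered on the domain {0<..1/2} only; the restriction
   enters through the inverses below. *)

definition h_l :: "real \<Rightarrow> real" where
  "h_l d = (- d * ln d - (1 - d) * ln (1 - d) + d * ln 6) / ((1 + d) * ln 2)"

definition h_u :: "real \<Rightarrow> real" where
  "h_u t = (- (1 - t) * log 2 (1 - t) - t * log 2 t + t) / (1 + t)"

(* h_l and h_u are strictly increasing on {0<..1/2} and their images contain {0<..1},
   so for 0 < \<alpha> \<le> 1 these are the unique preimages of \<alpha> in {0<..1/2}. *)

definition h_l_inv :: "real \<Rightarrow> real" where
  "h_l_inv = the_inv_into {0<..1/2} h_l"

definition h_u_inv :: "real \<Rightarrow> real" where
  "h_u_inv = the_inv_into {0<..1/2} h_u"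

definition lower_bound :: "real \<Rightarrow> real" where
  "lower_bound \<alpha> = h_l_inv \<alpha> / (1 + h_l_inv \<alpha>)"

definition upper_bound :: "real \<Rightarrow> real" where
  "upper_bound \<alpha> = h_u_inv \<alpha> / (1 + h_u_inv \<alpha>)"

end

theory Submission
  imports Defs "HOL-Real_Asymp.Real_Asymp"
begin

text \<open>
  Both functions are instances of
  \<open>g c d = (H d + c d) / ((1 + d) ln 2)\<close>, where \<open>H\<close> is the binary entropy in nats, with
  \<open>c = ln 6\<close> for \<open>h_l\<close> and \<open>c = ln 2\<close> for \<open>h_u\<close>. The term \<open>- d ln d\<close> dominates near 0,
  so \<open>h_l ((1 - \<epsilon>) t) < h_u t \<le> h_l t\<close> for every \<open>\<epsilon> > 0\<close> and all small \<open>t\<close>. Taking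
  \<open>t = h_u_inv \<alpha>\<close> yields \<open>(1 - \<epsilon>) h_u_inv \<alpha> < h_l_inv \<alpha> \<le> h_u_inv \<alpha>\<close>.
\<close>

definition entropy_quot :: "real \<Rightarrow> real \<Rightarrow> real" where
  "entropy_quot c d = (- d * ln d - (1 - d) * ln (1 - d) + d * c) / ((1 + d) * ln 2)"

lemma h_l_eq: "h_l = entropy_quot (ln 6)"
  by (simp add: fun_eq_iff h_l_def entropy_quot_def)

lemma h_u_eq: "h_u = entropy_quot (ln 2)"
proof
  fix t :: real
  have "- (1 - t) * log 2 (1 - t) - t * log 2 t + t
      = (- t * ln t - (1 - t) * ln (1 - t) + t * ln 2) / ln 2"
    by (simp add: log_def field_simps)
  then show "h_u t = entropy_quot (ln 2) t"
    by (simp add: h_u_def entropy_quot_def mult.commute)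
qed

lemma entropy_quot_mono_const:
  assumes "0 < d" "c \<le> c'"
  shows "entropy_quot c d \<le> entropy_quot c' d"
  unfolding entropy_quot_def using assms by (intro divide_right_mono) auto

lemma has_real_derivative_entropy_quot:
  assumes "0 < d" "d < 1"
  shows "(entropy_quot c has_real_derivative
           (c + 2 * ln (1 - d) - ln d) / ((1 + d)\<^sup>2 * ln 2)) (at d)"
proof -
  \<comment> \<open>The left side mirrors the unsimplified quotient-rule expression. In its
    numerator the \<open>d * ln d\<close> and \<open>d * c\<close> terms cancel, and the
    coefficients \<open>1 + d\<close> and \<open>1 - d\<close> of \<open>ln (1 - d)\<close> add up
    to 2.\<close>
  have eq: "((- 1 * ln d - d * (1 / d) + (ln (1 - d) + (1 - d) * (1 / (1 - d))) + c) * ((1 + d) * ln 2)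
      - (- d * ln d - (1 - d) * ln (1 - d) + d * c) * ln 2) / (((1 + d) * ln 2) * ((1 + d) * ln 2))
      = (c + 2 * ln (1 - d) - ln d) / ((1 + d)\<^sup>2 * ln 2)"
  proof -
    have "d * (1 / d) = 1" "(1 - d) * (1 / (1 - d)) = 1"
      using assms by auto
    moreover have "((- ln d + ln (1 - d) + c) * ((1 + d) * ln 2)
      - (- d * ln d - (1 - d) * ln (1 - d) + d * c) * ln 2)
      = (c + 2 * ln (1 - d) - ln d) * ln 2"
      by (simp add: algebra_simps)
    ultimately show ?thesis
      by (simp add: power2_eq_square)
  qed
  show ?thesis
    unfolding entropy_quot_def eq[symmetric]
    by (rule derivative_eq_intros refl | use assms in \<open>simp; fail\<close>)+
qed

lemma continuous_on_entropy_quot: "continuous_on {0<..1/2} (entropy_quot c)"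
  by (rule continuous_at_imp_continuous_on)
     (auto intro!: DERIV_isCont[OF has_real_derivative_entropy_quot])

text \<open>The derivative is positive as soon as d < 2 (1 - d)^2, which for d < 2 means d < 1/2.
  For c = ln 2 it vanishes at 1/2, so positivity is used on the open interval only.\<close>

lemma strict_mono_on_entropy_quot:
  assumes "ln 2 \<le> c"
  shows "strict_mono_on {0<..1/2} (entropy_quot c)"
proof (rule strict_mono_onI)
  fix x y :: real
  assume x: "x \<in> {0<..1/2}" and y: "y \<in> {0<..1/2}" and "x < y"
  show "entropy_quot c x < entropy_quot c y"
  proof (rule DERIV_pos_imp_increasing_open[OF \<open>x < y\<close>])
    fix z assume z: "x < z" "z < y"
    have z01: "0 < z" "z < 1/2" using z x y by auto
    have "z < 2 * (1 - z)\<^sup>2"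
    proof -
      have "0 < (1 - 2 * z) * (2 - z)" using z01 by simp
      then show ?thesis by (simp add: power2_eq_square algebra_simps)
    qed
    then have "ln z < ln (2 * (1 - z)\<^sup>2)" using z01 by simp
    also have "\<dots> = ln 2 + 2 * ln (1 - z)" using z01 by (simp add: ln_mult ln_realpow)
    finally have "0 < (c + 2 * ln (1 - z) - ln z) / ((1 + z)\<^sup>2 * ln 2)"
      using assms z01 by (intro divide_pos_pos mult_pos_pos) auto
    with has_real_derivative_entropy_quot[of z c] z01
    show "\<exists>l. (entropy_quot c has_real_derivative l) (at z) \<and> 0 < l" by auto
  next
    show "continuous_on {x..y} (entropy_quot c)"
      by (rule continuous_on_subset[OF continuous_on_entropy_quot]) (use x y in auto)
  qed
qed

lemma entropy_quot_tendsto_0: "(entropy_quot c \<longlongrightarrow> 0) (at_right 0)"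
  unfolding entropy_quot_def by real_asymp

text \<open>The leading terms differ by -\<epsilon> t ln t / ln 2, which is positive near 0 and
  outweighs the O(t) contributions of \<open>c\<close> and \<open>c'\<close>.\<close>

lemma eventually_entropy_quot_scaled_less:
  assumes "0 < \<epsilon>" "\<epsilon> < 1"
  shows "eventually (\<lambda>t. entropy_quot c ((1 - \<epsilon>) * t) < entropy_quot c' t) (at_right 0)"
  unfolding entropy_quot_def using assms by real_asymp

lemma eventually_the_inv_into_at_right_0:
  fixes f :: "real \<Rightarrow> real"
  assumes mono: "strict_mono_on {0<..b} f" and cont: "continuous_on {0<..b} f"
    and lim: "(f \<longlongrightarrow> 0) (at_right 0)" and \<delta>: "0 < \<delta>" "\<delta> \<le> b"
  shows "eventually (\<lambda>y. the_inv_into {0<..b} f y \<in> {0<..\<delta>} \<and>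
           f (the_inv_into {0<..b} f y) = y) (at_right 0)"
proof -
  have less: "f x < f y" if "0 < x" "x < y" "y \<le> b" for x y
    using strict_mono_onD[OF mono, of x y] that by auto
  \<comment> \<open>The limit yields only a weak inequality; evaluating at \<delta>/2 lets strict
    growth turn it into f \<delta> > 0.\<close>
  have "f (\<delta> / 2) \<ge> 0"
  proof (rule tendsto_upperbound[OF lim])
    have "eventually (\<lambda>x. x \<in> {0<..<\<delta> / 2}) (at_right 0)"
      using \<delta> by (intro eventually_at_right_real) auto
    then show "eventually (\<lambda>x. f x \<le> f (\<delta> / 2)) (at_right 0)"
      by eventually_elim (use \<delta> in \<open>auto intro!: less_imp_le less\<close>)
  qed auto
  moreover have "f (\<delta> / 2) < f \<delta>" using \<delta> by (intro less) auto
  ultimately have "eventually (\<lambda>y. y \<in> {0<..<f \<delta>}) (at_right 0)"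
    by (intro eventually_at_right_real) auto
  then show ?thesis
  proof eventually_elim
    case (elim y)
    \<comment> \<open>Since 0 lies outside the domain, the intermediate value theorem needs a left
      endpoint x > 0 with f x < y.\<close>
    have "eventually (\<lambda>x. x \<in> {0<..<\<delta>} \<and> f x < y) (at_right 0)"
      using \<delta> elim by (intro eventually_conj eventually_at_right_real order_tendstoD(2)[OF lim]) auto
    then obtain x where x: "0 < x" "x < \<delta>" "f x < y"
      using eventually_happens[of _ "at_right (0::real)"] by auto
    have "continuous_on {x..\<delta>} f"
      by (rule continuous_on_subset[OF cont]) (use x \<delta> in auto)
    then obtain z where z: "x \<le> z" "z \<le> \<delta>" "f z = y"
      using IVT'[of f x y \<delta>] x elim by auto
    have "the_inv_into {0<..b} f y = z"
      by (rule the_inv_into_f_eq[OF strict_mono_on_imp_inj_on[OF mono]])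
         (use x z \<delta> in auto)
    with x z show ?case by auto
  qed
qed

lemma eventually_h_l_inv:
  "eventually (\<lambda>\<alpha>. h_l_inv \<alpha> \<in> {0<..1/2} \<and> h_l (h_l_inv \<alpha>) = \<alpha>) (at_right 0)"
  unfolding h_l_inv_def h_l_eq
  by (rule eventually_the_inv_into_at_right_0)
     (simp_all add: strict_mono_on_entropy_quot continuous_on_entropy_quot entropy_quot_tendsto_0)

text \<open>A free \<delta> is needed because the scaled comparison holds only near 0 and is applied
  at \<open>h_u_inv \<alpha>\<close>. For \<open>h_l_inv \<alpha>\<close>, membership in the domain
  suffices.\<close>

lemma eventually_h_u_inv:
  assumes "0 < \<delta>" "\<delta> \<le> 1/2"
  shows "eventually (\<lambda>\<alpha>. h_u_inv \<alpha> \<in> {0<..\<delta>} \<and> h_u (h_u_inv \<alpha>) = \<alpha>) (at_right 0)"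
  unfolding h_u_inv_def h_u_eq using assms
  by (intro eventually_the_inv_into_at_right_0)
     (simp_all add: strict_mono_on_entropy_quot continuous_on_entropy_quot entropy_quot_tendsto_0)

lemma eventually_bounds_ratio:
  assumes \<epsilon>: "0 < \<epsilon>" "\<epsilon> < 1"
  shows "eventually (\<lambda>\<alpha>. 1 - \<epsilon> < lower_bound \<alpha> / upper_bound \<alpha> \<and>
           lower_bound \<alpha> / upper_bound \<alpha> \<le> 1) (at_right 0)"
proof -
  have "eventually (\<lambda>t. h_l ((1 - \<epsilon>) * t) < h_u t) (at_right 0)"
    unfolding h_l_eq h_u_eq by (rule eventually_entropy_quot_scaled_less[OF \<epsilon>])
  then obtain r where r: "r > 0" "\<And>t. 0 < t \<Longrightarrow> t < r \<Longrightarrow> h_l ((1 - \<epsilon>) * t) < h_u t"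
    unfolding eventually_at_right_field by auto
  define \<delta> where "\<delta> = min (1/2) (r / 2)"
  have \<delta>: "0 < \<delta>" "\<delta> \<le> 1/2" "\<delta> < r" using r(1) by (auto simp: \<delta>_def)
  have mono: "strict_mono_on {0<..1/2} h_l"
    unfolding h_l_eq by (rule strict_mono_on_entropy_quot) simp
  show ?thesis
    using eventually_h_l_inv eventually_h_u_inv[OF \<delta>(1,2)]
  proof eventually_elim
    case (elim \<alpha>)
    define a b where "a = h_l_inv \<alpha>" and "b = h_u_inv \<alpha>"
    have a: "0 < a" "a \<le> 1/2" "h_l a = \<alpha>" and b: "0 < b" "b \<le> \<delta>" "h_u b = \<alpha>"
      using elim by (auto simp: a_def b_def)
    have "h_u b \<le> h_l b"
      unfolding h_l_eq h_u_eq using b by (intro entropy_quot_mono_const) auto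
    then have "h_l a \<le> h_l b"
      using a b by simp
    then have ab: "a \<le> b"
      using strict_mono_onD[OF mono, of b a] a b \<delta> by fastforce
    have s: "0 < (1 - \<epsilon>) * b" "(1 - \<epsilon>) * b \<le> b"
      using \<epsilon> b by (auto simp: algebra_simps)
    \<comment> \<open>Both sides are compared through \<open>h_u b\<close>, which equals \<alpha> =
      \<open>h_l a\<close>.\<close>
    have "h_l ((1 - \<epsilon>) * b) < h_l a"
      using r(2)[of b] a b \<delta> by auto
    then have ba: "(1 - \<epsilon>) * b < a"
      using strict_mono_on_leD[OF mono, of a "(1 - \<epsilon>) * b"] a b \<delta> s by force
    have "1 - \<epsilon> < a / b" using ba b by (simp add: field_simps)
    \<comment> \<open>From a \<le> b the extra factor is at least 1, so passing from x to x / (1 +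
      x) keeps the lower estimate.\<close>
    also have "\<dots> \<le> a / b * ((1 + b) / (1 + a))"
      using a b ab mult_left_mono[of 1 "(1 + b) / (1 + a)" "a / b"] by simp
    also have "\<dots> = lower_bound \<alpha> / upper_bound \<alpha>"
      by (simp add: lower_bound_def upper_bound_def a_def b_def)
    finally have "1 - \<epsilon> < lower_bound \<alpha> / upper_bound \<alpha>" .
    moreover have "lower_bound \<alpha> \<le> upper_bound \<alpha>" "0 < upper_bound \<alpha>"
      unfolding lower_bound_def upper_bound_def a_def[symmetric] b_def[symmetric]
      using a b ab by (auto simp: field_simps)
    ultimately show ?case by simp
  qed
qed

theorem mainTheorem4:
  shows "((\<lambda>\<alpha>. lower_bound \<alpha> / upper_bound \<alpha>) \<longlongrightarrow> 1) (at_right 0)"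
proof (rule tendstoI)
  fix e :: real assume "0 < e"
  \<comment> \<open>The cap 1/2 ensures \<epsilon> < 1; the ratio then lies in (1 - \<epsilon>, 1],
    within distance e of 1.\<close>
  define \<epsilon> where "\<epsilon> = min e (1/2)"
  have \<epsilon>: "0 < \<epsilon>" "\<epsilon> < 1" "\<epsilon> \<le> e" using \<open>0 < e\<close> by (auto simp: \<epsilon>_def)
  from eventually_bounds_ratio[OF \<epsilon>(1,2)]
  show "eventually (\<lambda>\<alpha>. dist (lower_bound \<alpha> / upper_bound \<alpha>) 1 < e) (at_right 0)"
    by eventually_elim (use \<epsilon>(3) in \<open>auto simp: dist_real_def\<close>)
qed

end
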